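(* Every finite nonempty poset $P$ satisfies $$\operatorname{gap}(P)\le 2\,\mathrm{w}(P)-1 .$$
   Context: A linear extension of a finite poset $P$ with $n$ elements is an order-preserving bijection $f:P\to\{1,\dots,n\}$. For $x\in P$, $h_P(x)=\mathbb E[f(x)]$, where $f$ is a uniformly random linear extension of $P$. If $s_1\le\cdots\le s_n$ are the values $h_P(x)$, $x\in P$, listed with repetition, then $$\operatorname{gap}(P)=\max\{s_1,\ s_2-s_1,\ \ldots,\ s_n-s_{n-1},\ n+1-s_n\}.$$ The width $\mathrm{w}(P)$ is the largest size of a pairwise incomparable subset (antichain) of $P$. *)

theory Defs
  imports "HOL-Probability.Probability"
begin

text \<open>A finite poset is a finite carrier \<open>A\<close> with a reflexive order relation \<open>r\<close> such that
  \<open>partial_order_on A r\<close>; \<open>(x, y) \<in> r\<close> means \<open>x \<le> y\<close> in the poset.\<close>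

text \<open>The extensional function space \<open>\<rightarrow>\<^sub>E\<close> makes each linear extension a unique HOL function, so that
  the set is finite and its uniform distribution is the intended one.\<close>

definition linear_extensions :: "'a set \<Rightarrow> 'a rel \<Rightarrow> ('a \<Rightarrow> nat) set" where
  "linear_extensions A r =
     {f \<in> A \<rightarrow>\<^sub>E {1..card A}. bij_betw f A {1..card A} \<and> (\<forall>(x, y) \<in> r. f x \<le> f y)}"

definition avg_height :: "'a set \<Rightarrow> 'a rel \<Rightarrow> 'a \<Rightarrow> real" where
  "avg_height A r x =
     measure_pmf.expectation (pmf_of_set (linear_extensions A r)) (\<lambda>f. real (f x))"

definition sorted_heights :: "'a set \<Rightarrow> 'a rel \<Rightarrow> real list" where
  "sorted_heights A r = sorted_list_of_multiset (image_mset (avg_height A r) (mset_set A))"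

text \<open>List positions start at \<open>0\<close>: \<open>s\<^sub>i\<close> is \<open>sorted_heights A r ! (i - 1)\<close>.\<close>

definition gap :: "'a set \<Rightarrow> 'a rel \<Rightarrow> real" where
  "gap A r =
     (let n = card A; s = sorted_heights A r in
      Max ({s ! 0} \<union> {s ! Suc i - s ! i | i. Suc i < n} \<union> {real n + 1 - s ! (n - 1)}))"

definition antichain :: "'a set \<Rightarrow> 'a rel \<Rightarrow> 'a set \<Rightarrow> bool" where
  "antichain A r B \<longleftrightarrow>
     B \<subseteq> A \<and> (\<forall>x\<in>B. \<forall>y\<in>B. x \<noteq> y \<longrightarrow> (x, y) \<notin> r \<and> (y, x) \<notin> r)"

definition width :: "'a set \<Rightarrow> 'a rel \<Rightarrow> nat" where
  "width A r = Max {card B | B. antichain A r B}"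

end

theory Submission
  imports Defs
begin

text \<open>
  Let \<open>p\<^sub>J x\<close> be the probability that \<open>x\<close> comes last in a random linear extension of \<open>J\<close>. The
  recursion \<open>1 / p\<^sub>J y = 1 + (\<Sum>z. p\<^bsub>J - y\<^esub> z / p\<^bsub>J - z\<^esub> y)\<close>, with \<open>z \<noteq> y\<close> ranging over the maximal
  elements of \<open>J\<close>, shows by induction that \<open>p\<^sub>J y\<close> only grows when \<open>J\<close> shrinks to a down-set that
  still contains \<open>y\<close>. For two down-sets \<open>I\<close>, \<open>D\<close> it follows that the last element of \<open>I\<close> is a
  non-maximal element of \<open>D\<close> with probability at most that of the last element of \<open>D\<close> being
  outside \<open>I\<close>.

  Given an initial segment \<open>I\<close> of a random linear extension of the whole poset, its last element is
  distributed according to \<open>p\<^sub>I\<close>. Summing the inequality over all initial segments shows that the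
  heights of the maximal elements of \<open>D\<close>, averaged with weights \<open>p\<^sub>D\<close>, are at least
  \<open>|D| - |max D| + 1 \<ge> |D| - w + 1\<close>, so some element of \<open>D\<close> has height at least \<open>|D| - w + 1\<close>.
  Applying this to the elements of height at most \<open>s\<^sub>k\<close>, and dually to those of height at least
  \<open>s\<^sub>k\<close>, gives \<open>k - w + 1 \<le> s\<^sub>k \<le> k + w - 1\<close>, which bounds every difference of consecutive heights.
\<close>

section \<open>Maximal elements and down-closed subsets\<close>

definition maximals :: "'a rel \<Rightarrow> 'a set \<Rightarrow> 'a set" where
  "maximals r S = {z \<in> S. \<forall>y\<in>S. (z, y) \<in> r \<longrightarrow> y = z}"

definition down_closed :: "'a rel \<Rightarrow> 'a set \<Rightarrow> 'a set \<Rightarrow> bool" where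
  "down_closed r S I \<longleftrightarrow> I \<subseteq> S \<and> (\<forall>y\<in>I. \<forall>x\<in>S. (x, y) \<in> r \<longrightarrow> x \<in> I)"

lemma maximals_subset: "maximals r S \<subseteq> S"
  by (auto simp: maximals_def)

lemmas maximals_memD = subsetD[OF maximals_subset]

lemma finite_maximals [simp]: "finite S \<Longrightarrow> finite (maximals r S)"
  by (simp add: maximals_def)

lemma maximals_remove_Int:
  "x \<noteq> y \<Longrightarrow> maximals r (S - {x}) \<inter> maximals r (S - {y}) \<subseteq> maximals r S"
  by (auto simp: maximals_def)

lemma antichain_maximals: "antichain S r (maximals r S)"
  by (auto simp: antichain_def maximals_def)

lemma antichain_mono: "antichain S r B \<Longrightarrow> S \<subseteq> A \<Longrightarrow> antichain A r B"
  by (auto simp: antichain_def)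

lemma antichain_converse: "antichain A (r\<inverse>) B \<longleftrightarrow> antichain A r B"
  by (auto simp: antichain_def)

lemma width_converse: "width A (r\<inverse>) = width A r"
  by (simp add: width_def antichain_converse)

lemma card_antichain_le_width:
  assumes "finite A" "antichain A r B"
  shows "card B \<le> width A r"
proof -
  have "{card B | B. antichain A r B} \<subseteq> card ` Pow A"
    by (auto simp: antichain_def)
  then have "finite {card B | B. antichain A r B}"
    using assms(1) by (meson finite_Pow_iff finite_imageI finite_subset)
  then show ?thesis
    unfolding width_def using assms(2) by (intro Max_ge) auto
qed

lemma width_pos:
  assumes "finite A" "A \<noteq> {}"
  shows "width A r > 0"
proof -
  obtain a where "a \<in> A"
    using assms(2) by blast
  then have "antichain A r {a}"
    by (simp add: antichain_def)
  from card_antichain_le_width[OF assms(1) this] show ?thesis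
    by simp
qed

section \<open>Linear extensions and their top elements\<close>

abbreviation extensions_on :: "'a rel \<Rightarrow> 'a set \<Rightarrow> ('a \<Rightarrow> nat) set" where
  "extensions_on r S \<equiv> linear_extensions S (Restr r S)"

definition num_extensions :: "'a rel \<Rightarrow> 'a set \<Rightarrow> real" where
  "num_extensions r S = real (card (extensions_on r S))"

definition top_prob :: "'a rel \<Rightarrow> 'a set \<Rightarrow> 'a \<Rightarrow> real" where
  "top_prob r S z =
     (if z \<in> maximals r S then num_extensions r (S - {z}) / num_extensions r S else 0)"

definition initial_segment :: "'a set \<Rightarrow> ('a \<Rightarrow> nat) \<Rightarrow> 'a \<Rightarrow> 'a set" where
  "initial_segment S f z = {y \<in> S. f y \<le> f z}"

lemma finite_linear_extensions [simp]: "finite A \<Longrightarrow> finite (linear_extensions A r)"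
  unfolding linear_extensions_def
  by (rule finite_subset[of _ "A \<rightarrow>\<^sub>E {1..card A}"]) (auto intro: finite_PiE)

lemma extensions_on_iff:
  "f \<in> extensions_on r S \<longleftrightarrow> f \<in> extensional S \<and> bij_betw f S {1..card S} \<and>
     (\<forall>x\<in>S. \<forall>y\<in>S. (x, y) \<in> r \<longrightarrow> f x \<le> f y)"
  unfolding linear_extensions_def PiE_def bij_betw_def by auto

lemma
  assumes "f \<in> extensions_on r S"
  shows extensions_on_extensional: "f \<in> extensional S"
    and extensions_on_bij_betw: "bij_betw f S {1..card S}"
    and extensions_on_inj_on: "inj_on f S"
    and extensions_on_range: "x \<in> S \<Longrightarrow> f x \<in> {1..card S}"
    and extensions_on_mono: "x \<in> S \<Longrightarrow> y \<in> S \<Longrightarrow> (x, y) \<in> r \<Longrightarrow> f x \<le> f y"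
  using assms unfolding extensions_on_iff bij_betw_def by blast+

lemma extensions_on_empty: "extensions_on r {} = {\<lambda>_. undefined}"
  by (auto simp: linear_extensions_def bij_betw_def)

lemma top_mem_maximals:
  assumes "f \<in> extensions_on r S" "z \<in> S" "f z = card S"
  shows "z \<in> maximals r S"
proof -
  have "y = z" if "y \<in> S" "(z, y) \<in> r" for y
  proof -
    have "f y = f z"
      using extensions_on_mono[OF assms(1,2) that] extensions_on_range[OF assms(1) that(1)] assms(3)
      by simp
    then show ?thesis
      using inj_onD[OF extensions_on_inj_on[OF assms(1)]] that(1) assms(2) by blast
  qed
  then show ?thesis
    using assms(2) by (auto simp: maximals_def)
qed

lemma remove_top_mem_extensions_on:
  assumes "finite S" "f \<in> extensions_on r S" "z \<in> S" "f z = card S"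
  shows "f(z := undefined) \<in> extensions_on r (S - {z})"
proof -
  have "bij_betw f (S - {z}) ({1..card S} - {f z})"
    using extensions_on_bij_betw[OF assms(2)] assms(3) by (auto simp: bij_betw_def inj_on_def)
  moreover have "{1..card S} - {f z} = {1..card (S - {z})}"
    using assms by auto
  ultimately have "bij_betw f (S - {z}) {1..card (S - {z})}"
    by simp
  then have "bij_betw (f(z := undefined)) (S - {z}) {1..card (S - {z})}"
    by (subst bij_betw_cong[where g = f]) auto
  then show ?thesis
    using assms(2) unfolding extensions_on_iff by (auto simp: extensional_def)
qed

lemma add_top_mem_extensions_on:
  assumes "finite S" "z \<in> maximals r S" "f \<in> extensions_on r (S - {z})"
  shows "f(z := card S) \<in> extensions_on r S"
proof -
  let ?g = "f(z := card S)"
  have z: "z \<in> S" "\<And>y. y \<in> S \<Longrightarrow> (z, y) \<in> r \<Longrightarrow> y = z"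
    using assms(2) by (auto simp: maximals_def)
  have card: "card S = Suc (card (S - {z}))"
    by (rule card.remove[OF assms(1) z(1)])
  have "bij_betw ?g (S - {z}) {1..card (S - {z})}"
    using extensions_on_bij_betw[OF assms(3)] by (subst bij_betw_cong[where g = f]) auto
  then have "bij_betw ?g (insert z (S - {z})) (insert (card S) {1..card (S - {z})})"
    using notIn_Un_bij_betw[of z "S - {z}" ?g "{1..card (S - {z})}"] card by simp
  moreover have "insert z (S - {z}) = S" "insert (card S) {1..card (S - {z})} = {1..card S}"
    using z(1) card by auto
  ultimately have "bij_betw ?g S {1..card S}"
    by simp
  moreover have "?g \<in> extensional S"
    using extensions_on_extensional[OF assms(3)] z(1) by (auto simp: extensional_def)
  moreover have "?g x \<le> ?g y" if "x \<in> S" "y \<in> S" "(x, y) \<in> r" for x y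
  proof -
    have "f x < card S" if "x \<noteq> z"
      using extensions_on_range[OF assms(3), of x] \<open>x \<in> S\<close> that card by simp
    moreover have "y = z" if "x = z"
      using z(2)[of y] \<open>y \<in> S\<close> \<open>(x, y) \<in> r\<close> that by simp
    ultimately show ?thesis
      using extensions_on_mono[OF assms(3), of x y] that by (auto simp: less_imp_le)
  qed
  ultimately show ?thesis
    unfolding extensions_on_iff by blast
qed

lemma the_inv_into_extension_card:
  assumes "finite S" "S \<noteq> {}" "f \<in> extensions_on r S"
  shows "the_inv_into S f (card S) \<in> S" "f (the_inv_into S f (card S)) = card S"
proof -
  have "card S \<in> f ` S"
    using extensions_on_bij_betw[OF assms(3)] assms(1,2)
    by (simp add: bij_betw_def Suc_leI card_gt_0_iff)
  with extensions_on_inj_on[OF assms(3)]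
  show "the_inv_into S f (card S) \<in> S" "f (the_inv_into S f (card S)) = card S"
    by (auto intro: the_inv_into_into f_the_inv_into_f)
qed

lemma bij_betw_add_top:
  assumes "finite S" "S \<noteq> {}"
  shows "bij_betw (\<lambda>(z, f). f(z := card S))
    (SIGMA z:maximals r S. extensions_on r (S - {z})) (extensions_on r S)"
    (is "bij_betw ?add ?P _")
proof -
  let ?top = "\<lambda>f :: 'a \<Rightarrow> nat. the_inv_into S f (card S)"
  let ?remove = "\<lambda>f. (?top f, f(?top f := undefined))"
  note top = the_inv_into_extension_card[OF assms]
  show ?thesis
  proof (rule bij_betw_byWitness[where f' = ?remove])
    show "\<forall>p\<in>?P. ?remove (?add p) = p"
    proof
      fix p assume "p \<in> ?P"
      then obtain z f where p: "p = (z, f)" and z: "z \<in> maximals r S"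
          and f: "f \<in> extensions_on r (S - {z})"
        by auto
      have "?top (f(z := card S)) = z"
        using maximals_memD[OF z]
          extensions_on_inj_on[OF add_top_mem_extensions_on[OF assms(1) z f]]
        by (intro the_inv_into_f_eq) auto
      moreover have "f(z := undefined) = f"
        using extensions_on_extensional[OF f] by (auto simp: extensional_def)
      ultimately show "?remove (?add p) = p"
        by (simp add: p)
    qed
    show "\<forall>f\<in>extensions_on r S. ?add (?remove f) = f"
      by (simp add: top(2) fun_upd_idem)
    show "?add ` ?P \<subseteq> extensions_on r S"
      using add_top_mem_extensions_on[OF assms(1)] by auto
    show "?remove ` extensions_on r S \<subseteq> ?P"
    proof (rule image_subsetI)
      show "?remove f \<in> ?P" if "f \<in> extensions_on r S" for f
        using top_mem_maximals[OF that top[OF that]]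
          remove_top_mem_extensions_on[OF assms(1) that top[OF that]]
        by simp
    qed
  qed
qed

lemma sum_extensions_on:
  assumes "finite S" "S \<noteq> {}"
  shows "(\<Sum>f\<in>extensions_on r S. F f) =
    (\<Sum>z\<in>maximals r S. \<Sum>f\<in>extensions_on r (S - {z}). F (f(z := card S)))"
proof -
  have "(\<Sum>f\<in>extensions_on r S. F f) =
      (\<Sum>(z, f)\<in>(SIGMA z:maximals r S. extensions_on r (S - {z})). F (f(z := card S)))"
    by (simp add: sum.reindex_bij_betw[OF bij_betw_add_top[OF assms], symmetric] split_def)
  also have "\<dots> = (\<Sum>z\<in>maximals r S. \<Sum>f\<in>extensions_on r (S - {z}). F (f(z := card S)))"
    using assms(1) by (simp add: sum.Sigma)
  finally show ?thesis .
qed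

lemma num_extensions_empty [simp]: "num_extensions r {} = 1"
  unfolding num_extensions_def extensions_on_empty by simp

lemma num_extensions_rec:
  assumes "finite S" "S \<noteq> {}"
  shows "num_extensions r S = (\<Sum>z\<in>maximals r S. num_extensions r (S - {z}))"
  using sum_extensions_on[OF assms, where F = "\<lambda>_. 1 :: real"] by (simp add: num_extensions_def)

lemma top_prob_nonneg: "top_prob r S z \<ge> 0"
  by (simp add: top_prob_def num_extensions_def)

lemma card_less_extension_value:
  assumes "f \<in> extensions_on r S" "x \<in> S"
  shows "card {z \<in> S. f z < f x} = f x - 1"
proof -
  have "f ` {z \<in> S. f z < f x} = {1..<f x}"
  proof
    show "f ` {z \<in> S. f z < f x} \<subseteq> {1..<f x}"
      using extensions_on_range[OF assms(1)] by force
    show "{1..<f x} \<subseteq> f ` {z \<in> S. f z < f x}"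
    proof
      fix k assume "k \<in> {1..<f x}"
      moreover from this have "k \<in> f ` S"
        using extensions_on_bij_betw[OF assms(1)] extensions_on_range[OF assms]
        by (auto simp: bij_betw_def)
      ultimately show "k \<in> f ` {z \<in> S. f z < f x}"
        by auto
    qed
  qed
  moreover have "inj_on f {z \<in> S. f z < f x}"
    using extensions_on_inj_on[OF assms(1)] by (rule inj_on_subset) auto
  ultimately show ?thesis
    using card_image by fastforce
qed

lemma down_closed_initial_segment:
  "f \<in> extensions_on r S \<Longrightarrow> down_closed r S (initial_segment S f z)"
  using extensions_on_mono[of f S r] by (fastforce simp: down_closed_def initial_segment_def)

lemma initial_segment_add_top:
  assumes "finite S" "z \<in> S" "f \<in> extensions_on r (S - {z})"
  shows "initial_segment S (f(z := card S)) z = S"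
    and "x \<in> S - {z} \<Longrightarrow> initial_segment S (f(z := card S)) x = initial_segment (S - {z}) f x"
proof -
  have less: "f x < card S" if "x \<in> S - {z}" for x
    using extensions_on_range[OF assms(3) that] card_Diff1_less[OF assms(1,2)] by simp
  show "initial_segment S (f(z := card S)) z = S"
    using less by (force simp: initial_segment_def)
  show "initial_segment S (f(z := card S)) x = initial_segment (S - {z}) f x" if "x \<in> S - {z}"
    using less[OF that] that by (auto simp: initial_segment_def)
qed

lemma sum_initial_segments_add_top:
  assumes "finite S" "z \<in> S" "f \<in> extensions_on r (S - {z})"
  shows "(\<Sum>x\<in>S. G (initial_segment S (f(z := card S)) x)) =
    (\<Sum>x\<in>S - {z}. G (initial_segment (S - {z}) f x)) + G S"
  using initial_segment_add_top[OF assms] by (simp add: sum.remove[OF assms(1,2)] add.commute)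

definition reverse_extension :: "'a set \<Rightarrow> ('a \<Rightarrow> nat) \<Rightarrow> 'a \<Rightarrow> nat" where
  "reverse_extension A f = (\<lambda>x\<in>A. Suc (card A) - f x)"

lemma reverse_extension_mem:
  assumes "r \<subseteq> A \<times> A" "f \<in> linear_extensions A r"
  shows "reverse_extension A f \<in> linear_extensions A (r\<inverse>)"
proof -
  have f: "bij_betw f A {1..card A}" "\<And>x y. (x, y) \<in> r \<Longrightarrow> f x \<le> f y"
    using assms(2) by (auto simp: linear_extensions_def)
  have "bij_betw (\<lambda>k. Suc (card A) - k) {1..card A} {1..card A}"
    by (rule bij_betw_byWitness[where f' = "\<lambda>k. Suc (card A) - k"]) auto
  from bij_betw_trans[OF f(1) this]
  have bij: "bij_betw (reverse_extension A f) A {1..card A}"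
    by (subst bij_betw_cong[where g = "(\<lambda>k. Suc (card A) - k) \<circ> f"])
      (auto simp: reverse_extension_def)
  moreover from this have "reverse_extension A f \<in> A \<rightarrow>\<^sub>E {1..card A}"
    by (auto simp: PiE_def bij_betw_def reverse_extension_def)
  moreover have "reverse_extension A f y \<le> reverse_extension A f x" if "(x, y) \<in> r" for x y
    using f(2)[OF that] that assms(1) by (auto simp: reverse_extension_def intro: diff_le_mono2)
  ultimately show ?thesis
    unfolding linear_extensions_def by blast
qed

lemma reverse_reverse_extension:
  assumes "f \<in> linear_extensions A r"
  shows "reverse_extension A (reverse_extension A f) = f"
proof (rule extensionalityI[where A = A])
  show "reverse_extension A (reverse_extension A f) x = f x" if "x \<in> A" for x
  proof -
    have "f x \<in> {1..card A}"
      using assms that by (auto simp: linear_extensions_def)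
    then show ?thesis
      using that by (simp add: reverse_extension_def)
  qed
qed (use assms in \<open>auto simp: reverse_extension_def linear_extensions_def PiE_def\<close>)

lemma bij_betw_reverse_extension:
  assumes "r \<subseteq> A \<times> A"
  shows "bij_betw (reverse_extension A) (linear_extensions A r) (linear_extensions A (r\<inverse>))"
proof (rule bij_betw_byWitness[where f' = "reverse_extension A"])
  have "r\<inverse> \<subseteq> A \<times> A"
    using assms by blast
  then show "reverse_extension A ` linear_extensions A (r\<inverse>) \<subseteq> linear_extensions A r"
    using reverse_extension_mem[of "r\<inverse>" A] by auto
  show "reverse_extension A ` linear_extensions A r \<subseteq> linear_extensions A (r\<inverse>)"
    using reverse_extension_mem[OF assms] by auto
qed (simp_all add: reverse_reverse_extension)

section \<open>The distribution of the top element\<close>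

locale order_relation =
  fixes r :: "'a rel"
  assumes trans_rel: "trans r" and antisym_rel: "antisym r"
begin

lemma maximals_nonempty:
  assumes "finite S" "S \<noteq> {}"
  shows "maximals r S \<noteq> {}"
proof -
  have asymp: "asymp_on S (\<lambda>x y. (x, y) \<in> r \<and> x \<noteq> y)"
    using antisym_rel by (auto dest: antisymD)
  have transp: "transp_on S (\<lambda>x y. (x, y) \<in> r \<and> x \<noteq> y)"
    using antisym_rel trans_rel by (intro transp_onI) (blast dest: antisymD transD)
  obtain m where "m \<in> S" "\<forall>x\<in>S. x \<noteq> m \<longrightarrow> \<not> ((m, x) \<in> r \<and> m \<noteq> x)"
    using Finite_Set.bex_max_element[OF assms(1) asymp transp assms(2)] by blast
  then have "m \<in> maximals r S"
    by (auto simp: maximals_def)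
  then show ?thesis
    by blast
qed

lemma num_extensions_pos: "finite S \<Longrightarrow> num_extensions r S > 0"
proof (induction rule: finite_remove_induct)
  case (remove S)
  have "num_extensions r (S - {z}) > 0" if "z \<in> maximals r S" for z
    using remove.IH that maximals_memD[OF that] by blast
  then show ?case
    unfolding num_extensions_rec[OF remove.hyps(1,2)]
    using maximals_nonempty[OF remove.hyps(1,2)] remove.hyps(1) by (intro sum_pos) auto
qed simp

lemma top_prob_pos:
  assumes "finite S" "z \<in> maximals r S"
  shows "top_prob r S z > 0"
  using assms num_extensions_pos by (simp add: top_prob_def)

lemma num_extensions_mult_sum_top_prob:
  assumes "finite S"
  shows "num_extensions r S * (\<Sum>z\<in>S. top_prob r S z * F z) =
    (\<Sum>z\<in>maximals r S. num_extensions r (S - {z}) * F z)"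
proof -
  have "num_extensions r S * (\<Sum>z\<in>S. top_prob r S z * F z) =
      (\<Sum>z\<in>S. num_extensions r S * (top_prob r S z * F z))"
    by (rule sum_distrib_left)
  also have "\<dots> = (\<Sum>z\<in>maximals r S. num_extensions r (S - {z}) * F z)"
  proof (rule sum.mono_neutral_cong_right[OF assms maximals_subset])
    show "num_extensions r S * (top_prob r S z * F z) = num_extensions r (S - {z}) * F z"
      if "z \<in> maximals r S" for z
      using that num_extensions_pos[OF assms] by (simp add: top_prob_def)
  qed (simp add: top_prob_def)
  finally show ?thesis .
qed

lemma sum_top_prob:
  assumes "finite S" "S \<noteq> {}"
  shows "(\<Sum>z\<in>S. top_prob r S z) = 1"
  using num_extensions_mult_sum_top_prob[OF assms(1), of "\<lambda>_. 1"] num_extensions_pos[OF assms(1)]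
    num_extensions_rec[OF assms, of r]
  by simp

lemma sum_top_prob_le_1: "finite S \<Longrightarrow> (\<Sum>z\<in>S. top_prob r S z) \<le> 1"
  using sum_top_prob[of S] by (cases "S = {}") auto

lemma num_extensions_mult_sum_initial_segments:
  assumes "finite S"
  shows "num_extensions r S * (\<Sum>z\<in>S. F z) =
    (\<Sum>f\<in>extensions_on r S. \<Sum>x\<in>S. \<Sum>y\<in>initial_segment S f x.
      top_prob r (initial_segment S f x) y * F y)"
  using assms
proof (induction rule: finite_remove_induct)
  case (remove S)
  let ?e = "num_extensions r" and ?M = "maximals r S"
  let ?G = "\<lambda>I. \<Sum>y\<in>I. top_prob r I y * F y"
  have "?e S * (\<Sum>z\<in>S. F z) = (\<Sum>z\<in>?M. ?e (S - {z}) * (\<Sum>x\<in>S. F x))"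
    by (simp add: num_extensions_rec[OF remove.hyps(1,2), of r] sum_distrib_right)
  also have "\<dots> = (\<Sum>z\<in>?M. ?e (S - {z}) * (\<Sum>x\<in>S - {z}. F x) + ?e (S - {z}) * F z)"
    by (intro sum.cong refl)
      (simp add: sum.remove[OF remove.hyps(1) maximals_memD] distrib_left add.commute)
  also have "\<dots> = (\<Sum>z\<in>?M. ?e (S - {z}) * (\<Sum>x\<in>S - {z}. F x)) + ?e S * ?G S"
    by (simp add: sum.distrib num_extensions_mult_sum_top_prob[OF remove.hyps(1)])
  also have "\<dots> = (\<Sum>z\<in>?M. ?e (S - {z}) * (\<Sum>x\<in>S - {z}. F x) + ?e (S - {z}) * ?G S)"
    by (simp add: num_extensions_rec[OF remove.hyps(1,2), of r] sum_distrib_right sum.distrib)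
  also have "\<dots> = (\<Sum>z\<in>?M. \<Sum>f\<in>extensions_on r (S - {z}).
      (\<Sum>x\<in>S - {z}. ?G (initial_segment (S - {z}) f x)) + ?G S)"
    by (intro sum.cong refl)
      (simp add: remove.IH[OF maximals_memD] sum.distrib num_extensions_def[symmetric])
  also have "\<dots> = (\<Sum>z\<in>?M. \<Sum>f\<in>extensions_on r (S - {z}).
      \<Sum>x\<in>S. ?G (initial_segment S (f(z := card S)) x))"
    by (intro sum.cong refl)
      (rule sum_initial_segments_add_top[where G = ?G, OF remove.hyps(1) maximals_memD, symmetric])
  also have "\<dots> = (\<Sum>f\<in>extensions_on r S. \<Sum>x\<in>S. ?G (initial_segment S f x))"
    by (rule sum_extensions_on[OF remove.hyps(1,2), symmetric])
  finally show ?case .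
qed simp

lemma inverse_top_prob_rec:
  assumes "finite J" "y \<in> maximals r J"
  shows "1 / top_prob r J y =
    1 + (\<Sum>z\<in>maximals r J - {y}. top_prob r (J - {y}) z / top_prob r (J - {z}) y)"
proof -
  let ?e = "num_extensions r" and ?M = "maximals r J"
  have pos: "?e (J - B) > 0" for B
    using num_extensions_pos assms(1) by simp
  have quotient: "?e (J - {z}) / ?e (J - {y}) = top_prob r (J - {y}) z / top_prob r (J - {z}) y"
    if "z \<in> ?M - {y}" for z
  proof -
    have "z \<in> maximals r (J - {y})" "y \<in> maximals r (J - {z})"
      using that assms(2) by (auto simp: maximals_def)
    moreover have "J - {y} - {z} = J - {z} - {y}"
      by blast
    ultimately show ?thesis
      using pos[of "{y, z}"] by (simp add: top_prob_def flip: Diff_insert2)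
  qed
  have "J \<noteq> {}"
    using assms(2) by (auto simp: maximals_def)
  then have "?e J = ?e (J - {y}) + (\<Sum>z\<in>?M - {y}. ?e (J - {z}))"
    using num_extensions_rec[OF assms(1)] assms by (simp add: sum.remove)
  then have "1 / top_prob r J y = 1 + (\<Sum>z\<in>?M - {y}. ?e (J - {z}) / ?e (J - {y}))"
    using assms(2) pos[of "{y}"] by (simp add: top_prob_def add_divide_distrib sum_divide_distrib)
  then show ?thesis
    by (simp add: quotient)
qed

lemma sum_top_prob_increase_le:
  assumes "finite S" "x \<in> S" "N \<subseteq> S - {x}"
    and "\<And>z. z \<in> S - {x} \<Longrightarrow> top_prob r S z \<le> top_prob r (S - {x}) z"
  shows "(\<Sum>z\<in>N. top_prob r (S - {x}) z - top_prob r S z) \<le> top_prob r S x"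
proof -
  have "(\<Sum>z\<in>N. top_prob r (S - {x}) z - top_prob r S z) \<le>
      (\<Sum>z\<in>S - {x}. top_prob r (S - {x}) z - top_prob r S z)"
    using assms by (intro sum_mono2) auto
  also have "\<dots> \<le> 1 - (\<Sum>z\<in>S - {x}. top_prob r S z)"
    using sum_top_prob_le_1[of "S - {x}"] assms(1) by (simp add: sum_subtractf)
  also have "\<dots> = top_prob r S x"
    using sum_top_prob[OF assms(1)] sum.remove[OF assms(1,2), of "top_prob r S"] assms(2) by force
  finally show ?thesis .
qed

text \<open>
  Comparing \<open>inverse_top_prob_rec\<close> for \<open>J\<close> and for \<open>J - {x}\<close>, the sum for \<open>J\<close> has smaller weights
  \<open>top_prob r (J - {y}) z\<close> but an additional term for \<open>z = x\<close>. Its weight makes up for the total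
  loss of the others, and its factor \<open>1 / top_prob r (J - {x}) y\<close> is the largest one.
\<close>

context
  fixes J x y
  assumes finite_J: "finite J"
    and x_maximal: "x \<in> maximals r J" and y_maximal: "y \<in> maximals r J" and x_neq_y: "x \<noteq> y"
begin

lemma inverse_top_prob_remove_maximal_le:
  assumes mono_remove_x: "\<And>z. z \<in> J - {y} - {x} \<Longrightarrow>
      top_prob r (J - {y}) z \<le> top_prob r (J - {y} - {x}) z"
    and mono_remove_z: "\<And>z. z \<in> maximals r (J - {x}) - {y} \<Longrightarrow>
      top_prob r (J - {x}) y \<le> top_prob r (J - {x} - {z}) y"
  shows "1 / top_prob r (J - {x}) y \<le>
    1 + (\<Sum>z\<in>maximals r (J - {x}) - {y}. top_prob r (J - {y}) z / top_prob r (J - {x} - {z}) y)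
      + top_prob r (J - {y}) x / top_prob r (J - {x}) y"
proof -
  let ?p = "top_prob r" and ?A = "J - {x}"
  let ?N = "maximals r ?A - {y}"
  have A: "finite ?A" "y \<in> maximals r ?A" "?A - {y} = J - {y} - {x}"
    using finite_J y_maximal x_neq_y by (auto simp: maximals_def)
  have N_subset: "?N \<subseteq> J - {y} - {x}"
    by (auto dest: maximals_memD)
  have pos: "?p ?A y > 0"
    using A(1,2) by (rule top_prob_pos)
  have "(\<Sum>z\<in>?N. (?p (?A - {y}) z - ?p (J - {y}) z) / ?p (?A - {z}) y)
      \<le> (\<Sum>z\<in>?N. (?p (?A - {y}) z - ?p (J - {y}) z) / ?p ?A y)"
  proof (intro sum_mono divide_left_mono)
    fix z assume z: "z \<in> ?N"
    show "?p ?A y \<le> ?p (?A - {z}) y"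
      using z by (rule mono_remove_z)
    with pos show "0 < ?p (?A - {z}) y * ?p ?A y"
      by simp
    show "0 \<le> ?p (?A - {y}) z - ?p (J - {y}) z"
      using mono_remove_x N_subset z A(3) by auto
  qed
  also have "\<dots> = (\<Sum>z\<in>?N. ?p (J - {y} - {x}) z - ?p (J - {y}) z) / ?p ?A y"
    by (simp add: A(3) sum_divide_distrib)
  also have "\<dots> \<le> ?p (J - {y}) x / ?p ?A y"
    using finite_J x_maximal x_neq_y N_subset mono_remove_x pos
    by (intro divide_right_mono sum_top_prob_increase_le) (auto dest: maximals_memD)
  finally show ?thesis
    by (simp add: inverse_top_prob_rec[OF A(1,2)] diff_divide_distrib sum_subtractf)
qed

lemma inverse_top_prob_ge:
  assumes mono_remove_x: "\<And>z. z \<in> maximals r J - {y} - {x} \<Longrightarrow>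
      top_prob r (J - {z}) y \<le> top_prob r (J - {x} - {z}) y"
  shows "1 + (\<Sum>z\<in>maximals r (J - {x}) - {y}. top_prob r (J - {y}) z / top_prob r (J - {x} - {z}) y)
      + top_prob r (J - {y}) x / top_prob r (J - {x}) y \<le> 1 / top_prob r J y"
proof -
  let ?p = "top_prob r" and ?M = "maximals r J - {y}" and ?N = "maximals r (J - {x}) - {y}"
  have "(\<Sum>z\<in>?N. ?p (J - {y}) z / ?p (J - {x} - {z}) y)
      = (\<Sum>z\<in>?M - {x}. ?p (J - {y}) z / ?p (J - {x} - {z}) y)"
  proof (rule sum.mono_neutral_right)
    show "?M - {x} \<subseteq> ?N"
      by (auto simp: maximals_def)
    show "\<forall>z\<in>?N - (?M - {x}). ?p (J - {y}) z / ?p (J - {x} - {z}) y = 0"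
      using maximals_remove_Int[OF x_neq_y, of r J] by (auto simp: top_prob_def dest: maximals_memD)
  qed (simp add: finite_J)
  also have "\<dots> \<le> (\<Sum>z\<in>?M - {x}. ?p (J - {y}) z / ?p (J - {z}) y)"
  proof (intro sum_mono divide_left_mono top_prob_nonneg)
    fix z assume z: "z \<in> ?M - {x}"
    have "?p (J - {z}) y > 0"
      using finite_J y_maximal z by (intro top_prob_pos) (auto simp: maximals_def)
    with mono_remove_x[OF z] show "0 < ?p (J - {x} - {z}) y * ?p (J - {z}) y"
      by simp
  qed (rule mono_remove_x)
  also have "\<dots> = 1 / ?p J y - 1 - ?p (J - {y}) x / ?p (J - {x}) y"
    using finite_J x_maximal x_neq_y
    by (simp add: inverse_top_prob_rec[OF finite_J y_maximal] sum.remove[of ?M x])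
  finally show ?thesis
    by simp
qed

end

lemma top_prob_le_remove_maximal:
  assumes "finite J" "x \<in> maximals r J" "y \<in> J - {x}"
  shows "top_prob r J y \<le> top_prob r (J - {x}) y"
  using assms
proof (induction J arbitrary: x y rule: finite_psubset_induct)
  case (psubset J)
  let ?p = "top_prob r"
  show ?case
  proof (cases "y \<in> maximals r J")
    case True
    have mem: "x \<in> J" "y \<in> J" and x_neq_y: "x \<noteq> y"
      and y_maximal: "y \<in> maximals r (J - {x})"
      using psubset.prems True by (auto simp: maximals_def)
    have "?p (J - {y}) z \<le> ?p (J - {y} - {x}) z" if "z \<in> J - {y} - {x}" for z
      using psubset.IH[of "J - {y}" x z] psubset.prems mem x_neq_y that by (auto simp: maximals_def)
    moreover have "?p (J - {x}) y \<le> ?p (J - {x} - {z}) y" if "z \<in> maximals r (J - {x}) - {y}" for z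
      using psubset.IH[of "J - {x}" z y] mem x_neq_y that by auto
    ultimately have "1 / ?p (J - {x}) y \<le> 1 +
        (\<Sum>z\<in>maximals r (J - {x}) - {y}. ?p (J - {y}) z / ?p (J - {x} - {z}) y)
        + ?p (J - {y}) x / ?p (J - {x}) y"
      by (rule inverse_top_prob_remove_maximal_le[OF psubset.hyps psubset.prems(1) True x_neq_y])
    also have "\<dots> \<le> 1 / ?p J y"
    proof (rule inverse_top_prob_ge[OF psubset.hyps psubset.prems(1) True x_neq_y])
      fix z assume z: "z \<in> maximals r J - {y} - {x}"
      have "J - {x} - {z} = J - {z} - {x}"
        by blast
      then show "?p (J - {z}) y \<le> ?p (J - {x} - {z}) y"
        using psubset.IH[of "J - {z}" x y] psubset.prems mem x_neq_y z by (auto simp: maximals_def)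
    qed
    finally show ?thesis
      using top_prob_pos[OF psubset.hyps True] top_prob_pos[OF _ y_maximal] psubset.hyps
      by (simp add: field_simps)
  qed (simp add: top_prob_nonneg top_prob_def[of r J])
qed

lemma top_prob_antimono:
  assumes "finite J" "down_closed r J I" "z \<in> I"
  shows "top_prob r J z \<le> top_prob r I z"
  using assms
proof (induction J rule: finite_psubset_induct)
  case (psubset J)
  show ?case
  proof (cases "J = I")
    case False
    then have "J - I \<noteq> {}"
      using psubset.prems by (auto simp: down_closed_def)
    then obtain y where "y \<in> maximals r (J - I)"
      using maximals_nonempty[of "J - I"] psubset.hyps by auto
    then have y: "y \<in> maximals r J" "y \<in> J" "y \<notin> I"
      using psubset.prems(1) by (auto simp: maximals_def down_closed_def)
    then have "down_closed r (J - {y}) I"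
      using psubset.prems(1) by (auto simp: down_closed_def)
    then have "top_prob r (J - {y}) z \<le> top_prob r I z"
      using psubset.IH[of "J - {y}"] psubset.prems(2) y by blast
    moreover have "top_prob r J z \<le> top_prob r (J - {y}) z"
      using psubset.hyps psubset.prems y
      by (intro top_prob_le_remove_maximal) (auto simp: down_closed_def)
    ultimately show ?thesis
      by simp
  qed simp
qed

lemma sum_nonmaximal_top_prob_le:
  assumes "finite S" "down_closed r S I" "down_closed r S D" "D \<noteq> {}"
  shows "(\<Sum>z\<in>I \<inter> (D - maximals r D). top_prob r I z) \<le> (\<Sum>z\<in>D - I. top_prob r D z)"
proof (cases "I \<inter> D = {}")
  case True
  then have "I \<inter> (D - maximals r D) = {}"
    by blast
  then show ?thesis
    by (simp only: sum.empty sum_nonneg top_prob_nonneg)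
next
  case False
  let ?K = "I \<inter> D" and ?M = "maximals r D"
  have finite_I_D: "finite I" "finite D"
    using assms(1-3) by (auto simp: down_closed_def intro: finite_subset)
  have down_closed_Int: "down_closed r I ?K" "down_closed r D ?K"
    using assms(2,3) by (auto simp: down_closed_def)
  have "(\<Sum>z\<in>I \<inter> (D - ?M). top_prob r I z) \<le> (\<Sum>z\<in>?K - ?M. top_prob r ?K z)"
    unfolding Int_Diff using top_prob_antimono[OF finite_I_D(1) down_closed_Int(1)]
    by (intro sum_mono) auto
  also have "\<dots> = 1 - (\<Sum>z\<in>?K \<inter> ?M. top_prob r ?K z)"
    using sum_top_prob[OF _ False] sum.Int_Diff[of ?K "top_prob r ?K" ?M] finite_I_D by simp
  also have "\<dots> \<le> 1 - (\<Sum>z\<in>?K \<inter> ?M. top_prob r D z)"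
    using top_prob_antimono[OF finite_I_D(2) down_closed_Int(2)]
    by (intro diff_left_mono sum_mono) auto
  also have "(\<Sum>z\<in>?K \<inter> ?M. top_prob r D z) = (\<Sum>z\<in>D \<inter> I. top_prob r D z)"
    using finite_I_D by (intro sum.mono_neutral_left) (auto simp: top_prob_def)
  also have "1 - \<dots> = (\<Sum>z\<in>D - I. top_prob r D z)"
    using sum_top_prob[OF finite_I_D(2) assms(4)]
      sum.Int_Diff[OF finite_I_D(2), of "top_prob r D" I] by simp
  finally show ?thesis .
qed

lemma sum_initial_segment_nonmaximal_le:
  assumes "finite S" "f \<in> extensions_on r S" "down_closed r S D" "D \<noteq> {}"
  shows "(\<Sum>y\<in>initial_segment S f z.
      top_prob r (initial_segment S f z) y * of_bool (y \<in> D - maximals r D))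
    \<le> (\<Sum>x\<in>D. top_prob r D x * of_bool (f z < f x))"
proof -
  let ?I = "initial_segment S f z"
  have finite_I_D: "finite ?I" "finite D"
    using assms(1,3) by (auto simp: initial_segment_def down_closed_def intro: finite_subset)
  then have "(\<Sum>y\<in>?I. top_prob r ?I y * of_bool (y \<in> D - maximals r D))
      = (\<Sum>y\<in>?I \<inter> (D - maximals r D). top_prob r ?I y)"
    by (simp del: Diff_iff)
  also have "\<dots> \<le> (\<Sum>x\<in>D - ?I. top_prob r D x)"
    using assms(1) down_closed_initial_segment[OF assms(2)] assms(3,4)
    by (rule sum_nonmaximal_top_prob_le)
  also have "\<dots> = (\<Sum>x\<in>D. top_prob r D x * of_bool (f z < f x))"
    using assms(3) finite_I_D(2)
    by (intro sum.mono_neutral_cong_left) (auto simp: initial_segment_def down_closed_def)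
  finally show ?thesis .
qed

lemma card_nonmaximal_le_weighted_sum:
  assumes "finite S" "down_closed r S D" "D \<noteq> {}"
  shows "num_extensions r S * real (card (D - maximals r D)) \<le>
    (\<Sum>x\<in>D. top_prob r D x * (\<Sum>f\<in>extensions_on r S. real (f x) - 1))"
proof -
  let ?N = "D - maximals r D" and ?L = "extensions_on r S"
  have "D \<subseteq> S"
    using assms(2) by (simp add: down_closed_def)
  then have "S \<inter> ?N = ?N"
    by blast
  then have "real (card ?N) = (\<Sum>z\<in>S. of_bool (z \<in> ?N))"
    using assms(1) by (simp del: Diff_iff)
  then have "num_extensions r S * real (card ?N) = (\<Sum>f\<in>?L. \<Sum>z\<in>S.
      \<Sum>y\<in>initial_segment S f z. top_prob r (initial_segment S f z) y * of_bool (y \<in> ?N))"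
    by (simp only: num_extensions_mult_sum_initial_segments[OF assms(1)])
  also have "\<dots> \<le> (\<Sum>f\<in>?L. \<Sum>z\<in>S. \<Sum>x\<in>D. top_prob r D x * of_bool (f z < f x))"
    using assms by (intro sum_mono sum_initial_segment_nonmaximal_le)
  also have "\<dots> = (\<Sum>f\<in>?L. \<Sum>x\<in>D. top_prob r D x * (real (f x) - 1))"
  proof (rule sum.cong[OF refl])
    fix f assume f: "f \<in> ?L"
    have "(\<Sum>z\<in>S. of_bool (f z < f x)) = real (f x) - 1" if "x \<in> D" for x
    proof -
      have "x \<in> S"
        using that \<open>D \<subseteq> S\<close> by blast
      then show ?thesis
        using card_less_extension_value[OF f, of x] extensions_on_range[OF f, of x] assms(1)
        by (simp add: Int_def)
    qed
    then show "(\<Sum>z\<in>S. \<Sum>x\<in>D. top_prob r D x * of_bool (f z < f x)) =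
        (\<Sum>x\<in>D. top_prob r D x * (real (f x) - 1))"
      by (subst sum.swap) (simp flip: sum_distrib_left)
  qed
  also have "\<dots> = (\<Sum>x\<in>D. top_prob r D x * (\<Sum>f\<in>?L. real (f x) - 1))"
    by (subst sum.swap) (simp add: sum_distrib_left)
  finally show ?thesis .
qed

end

section \<open>Average heights\<close>

lemma length_sorted_heights: "length (sorted_heights A r) = card A"
  unfolding sorted_heights_def
  by (metis mset_sorted_list_of_multiset size_image_mset size_mset size_mset_set)

lemma card_avg_height_conv_sorted_heights:
  assumes "finite A"
  shows "card {x \<in> A. P (avg_height A r x)} =
    card {i. i < length (sorted_heights A r) \<and> P (sorted_heights A r ! i)}"
proof -
  have "length (filter P (sorted_heights A r)) = size (filter_mset P (mset (sorted_heights A r)))"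
    by (metis mset_filter size_mset)
  also have "\<dots> = card {x \<in> A. P (avg_height A r x)}"
    by (simp add: sorted_heights_def filter_mset_image_mset assms)
  finally show ?thesis
    by (simp add: length_filter_conv_card)
qed

lemma gap_le_iff:
  "gap A r \<le> b \<longleftrightarrow> sorted_heights A r ! 0 \<le> b \<and>
     (\<forall>i. Suc i < card A \<longrightarrow> sorted_heights A r ! Suc i - sorted_heights A r ! i \<le> b) \<and>
     real (card A) + 1 - sorted_heights A r ! (card A - 1) \<le> b"
proof -
  have "finite {sorted_heights A r ! Suc i - sorted_heights A r ! i | i. Suc i < card A}"
    by (rule finite_surj[of "{..<card A}"]) auto
  then show ?thesis
    unfolding gap_def Let_def by (subst Max_le_iff) auto
qed

locale finite_poset =
  fixes A :: "'a set" and r :: "'a rel"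
  assumes finite_carrier: "finite A" and partial_order: "partial_order_on A r"
begin

sublocale order_relation r
  using partial_order by unfold_locales (auto simp: partial_order_on_def preorder_on_def)

lemma relation_subset: "r \<subseteq> A \<times> A"
  using partial_order by (auto simp: partial_order_on_def preorder_on_def)

lemma extensions_on_carrier: "extensions_on r A = linear_extensions A r"
  using relation_subset by (simp add: Int_absorb2)

lemma card_linear_extensions_pos: "card (linear_extensions A r) > 0"
  using num_extensions_pos[OF finite_carrier]
  by (simp add: num_extensions_def extensions_on_carrier)

lemma avg_height_eq:
  "avg_height A r x =
     (\<Sum>f\<in>linear_extensions A r. real (f x)) / real (card (linear_extensions A r))"
proof -
  have "linear_extensions A r \<noteq> {}"
    using card_linear_extensions_pos by force
  then show ?thesis
    unfolding avg_height_def using finite_carrier by (simp add: integral_pmf_of_set)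
qed

lemma avg_height_mono: "(x, y) \<in> r \<Longrightarrow> avg_height A r x \<le> avg_height A r y"
  unfolding avg_height_eq
  by (intro divide_right_mono sum_mono) (auto simp: linear_extensions_def)

lemma weighted_avg_height_ge:
  assumes "down_closed r A D" "D \<noteq> {}"
  shows "real (card (D - maximals r D)) + 1 \<le> (\<Sum>x\<in>D. top_prob r D x * avg_height A r x)"
proof -
  let ?e = "real (card (linear_extensions A r))"
  have "finite D"
    using assms(1) finite_carrier by (auto simp: down_closed_def intro: finite_subset)
  note sum_weights = sum_top_prob[OF this assms(2)]
  have "?e * real (card (D - maximals r D)) \<le>
      (\<Sum>x\<in>D. top_prob r D x * (\<Sum>f\<in>linear_extensions A r. real (f x) - 1))"
    using card_nonmaximal_le_weighted_sum[OF finite_carrier assms]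
    by (simp add: num_extensions_def extensions_on_carrier)
  also have "\<dots> = (\<Sum>x\<in>D. ?e * (top_prob r D x * avg_height A r x - top_prob r D x))"
    using card_linear_extensions_pos
    by (intro sum.cong refl) (simp add: avg_height_eq sum_subtractf field_simps)
  also have "\<dots> = ?e * ((\<Sum>x\<in>D. top_prob r D x * avg_height A r x) - 1)"
    by (simp add: sum_weights sum_subtractf flip: sum_distrib_left)
  finally show ?thesis
    using card_linear_extensions_pos by simp
qed

lemma exists_avg_height_ge:
  assumes "down_closed r A D" "D \<noteq> {}"
  shows "\<exists>x\<in>D. avg_height A r x \<ge> real (card D) + 1 - real (width A r)"
proof -
  let ?h = "avg_height A r"
  have D_subset: "D \<subseteq> A" and finite_D: "finite D"
    using assms(1) finite_carrier by (auto simp: down_closed_def intro: finite_subset)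
  have "card (maximals r D) \<le> width A r"
    using finite_carrier antichain_mono[OF antichain_maximals D_subset]
    by (rule card_antichain_le_width)
  then have "real (card D) + 1 - real (width A r) \<le> real (card (D - maximals r D)) + 1"
    using diff_card_le_card_Diff[of "maximals r D" D] finite_D by simp
  also have "\<dots> \<le> (\<Sum>x\<in>D. top_prob r D x * ?h x)"
    using assms by (rule weighted_avg_height_ge)
  also have "\<dots> \<le> (\<Sum>x\<in>D. top_prob r D x * Max (?h ` D))"
    using finite_D by (intro sum_mono mult_left_mono top_prob_nonneg) auto
  also have "\<dots> = Max (?h ` D)"
    using sum_top_prob[OF finite_D assms(2)] by (simp flip: sum_distrib_right)
  finally show ?thesis
    using Max_in[of "?h ` D"] finite_D assms(2) by fastforce
qed

lemma avg_height_converse: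
  assumes "x \<in> A"
  shows "avg_height A (r\<inverse>) x = real (card A) + 1 - avg_height A r x"
proof -
  interpret dual: finite_poset A "r\<inverse>"
    using finite_carrier partial_order by unfold_locales auto
  let ?L = "linear_extensions A r"
  note bij = bij_betw_reverse_extension[OF relation_subset]
  have "(\<Sum>f\<in>linear_extensions A (r\<inverse>). real (f x)) = (\<Sum>f\<in>?L. real (reverse_extension A f x))"
    by (rule sum.reindex_bij_betw[OF bij, symmetric])
  also have "\<dots> = (\<Sum>f\<in>?L. real (card A) + 1 - real (f x))"
  proof (intro sum.cong refl)
    fix f assume "f \<in> ?L"
    then have "f x \<le> card A"
      using assms by (auto simp: linear_extensions_def)
    then show "real (reverse_extension A f x) = real (card A) + 1 - real (f x)"
      using assms by (simp add: reverse_extension_def)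
  qed
  also have "\<dots> = real (card ?L) * (real (card A) + 1) - (\<Sum>f\<in>?L. real (f x))"
    by (simp add: sum_subtractf)
  finally show ?thesis
    using card_linear_extensions_pos bij_betw_same_card[OF bij]
    by (simp add: avg_height_eq dual.avg_height_eq field_simps)
qed

lemma exists_avg_height_le:
  assumes "down_closed (r\<inverse>) A U" "U \<noteq> {}"
  shows "\<exists>x\<in>U. avg_height A r x \<le> real (card A) - real (card U) + real (width A r)"
proof -
  interpret dual: finite_poset A "r\<inverse>"
    using finite_carrier partial_order by unfold_locales auto
  obtain x where x: "x \<in> U" "real (card U) + 1 - real (width A r) \<le> avg_height A (r\<inverse>) x"
    using dual.exists_avg_height_ge[OF assms] by (auto simp: width_converse)
  moreover from x(1) have "x \<in> A"
    using assms(1) by (auto simp: down_closed_def)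
  ultimately show ?thesis
    by (intro bexI[of _ x]) (simp_all add: avg_height_converse)
qed

lemma sorted_heights_bounds:
  assumes "i < card A"
  shows "real i + 2 - real (width A r) \<le> sorted_heights A r ! i"
    and "sorted_heights A r ! i \<le> real i + real (width A r)"
proof -
  let ?h = "avg_height A r" and ?s = "sorted_heights A r"
  define D where "D = {x \<in> A. ?h x \<le> ?s ! i}"
  define U where "U = {x \<in> A. ?s ! i \<le> ?h x}"
  have sorted: "sorted ?s"
    by (simp add: sorted_heights_def)
  have i_less: "i < length ?s"
    using assms by (simp add: length_sorted_heights)
  have closed: "down_closed r A D" "down_closed (r\<inverse>) A U"
    using avg_height_mono by (fastforce simp: down_closed_def D_def U_def)+
  have "card {..i} \<le> card {j. j < length ?s \<and> ?s ! j \<le> ?s ! i}"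
    using sorted i_less by (intro card_mono) (auto simp: sorted_nth_mono)
  then have card_D: "Suc i \<le> card D"
    using card_avg_height_conv_sorted_heights[OF finite_carrier, of "\<lambda>t. t \<le> ?s ! i"]
    by (simp add: D_def)
  have "card {i..<length ?s} \<le> card {j. j < length ?s \<and> ?s ! i \<le> ?s ! j}"
    using sorted i_less by (intro card_mono) (auto simp: sorted_nth_mono)
  then have card_U: "card A - i \<le> card U"
    using card_avg_height_conv_sorted_heights[OF finite_carrier, of "\<lambda>t. ?s ! i \<le> t"]
    by (simp add: U_def length_sorted_heights)
  obtain x where "x \<in> D" "real (card D) + 1 - real (width A r) \<le> ?h x"
    using exists_avg_height_ge[OF closed(1)] card_D by fastforce
  then show "real i + 2 - real (width A r) \<le> ?s ! i"
    using card_D by (auto simp: D_def)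
  obtain y where "y \<in> U" "?h y \<le> real (card A) - real (card U) + real (width A r)"
    using exists_avg_height_le[OF closed(2)] card_U assms by fastforce
  then show "?s ! i \<le> real i + real (width A r)"
    using card_U assms by (auto simp: U_def)
qed

end

theorem corollary4p2:
  fixes A :: "'a set" and r :: "'a rel"
  assumes "finite A" and "A \<noteq> {}" and "partial_order_on A r"
  shows "gap A r \<le> 2 * real (width A r) - 1"
  unfolding gap_le_iff
proof (intro conjI allI impI)
  interpret finite_poset A r
    using assms by unfold_locales
  have card_pos: "0 < card A" and width_ge_1: "1 \<le> real (width A r)"
    using assms width_pos[OF assms(1,2), of r] by (simp_all add: card_gt_0_iff)
  show "sorted_heights A r ! 0 \<le> 2 * real (width A r) - 1"
    using sorted_heights_bounds(2)[OF card_pos] width_ge_1 by simp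
  show "sorted_heights A r ! Suc i - sorted_heights A r ! i \<le> 2 * real (width A r) - 1"
    if "Suc i < card A" for i
    using sorted_heights_bounds(1)[of i] sorted_heights_bounds(2)[OF that] that by simp
  show "real (card A) + 1 - sorted_heights A r ! (card A - 1) \<le> 2 * real (width A r) - 1"
    using sorted_heights_bounds(1)[of "card A - 1"] card_pos width_ge_1 by simp
qed

end
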